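(* Let $\mu$ be a finite positive Borel measure on $\mathbb{T}$ and let $E\subset\mathbb{T}$ be a closed set of Lebesgue measure zero. If $\rho_{\mu,E}(t)=O(t^\alpha)$ as $t\to0^+$ with $\alpha>2$, then $c_\mu(E)=0$.
   Context: $\mathbb{T}$ is the unit circle; $L^2(\mathbb{T})$ is taken with respect to $dt/2\pi$. For $f\in L^2(\mathbb{T})$ put $$\mathcal{D}_\mu(f)=\int_{\mathbb{T}}\left(\int_{\mathbb{T}}\frac{|f(e^{it})-f(\xi)|^2}{|e^{it}-\xi|^2}\frac{dt}{2\pi}\right)d\mu(\xi),$$ where $f(\xi)$ is the non-tangential limit at $\xi$ of the Poisson integral of $f$ (the inner integral is $+\infty$ where this limit does not exist), and $\mathcal{D}^h(\mu)=\{f\in L^2(\mathbb{T}):\|f\|_\mu^2:=\|f\|_{L^2(\mathbb{T})}^2+\mathcal{D}_\mu(f)<\infty\}$. For $U\subset\mathbb{T}$ open, $c_\mu(U)=\inf\{\|u\|_\mu^2: u\in\mathcal{D}^h(\mu),\ u\ge0,\ u\ge1\text{ a.e. on }U\}$; for any $F\subset\mathbb{T}$, $c_\mu(F)=\inf\{c_\mu(U):U\text{ open},\ F\subset U\}$. $\rho_{\mu,E}(t)=\sup\{\mu(\zeta e^{-it},\zeta e^{it}):\zeta\in E\}$, where $(\zeta e^{-it},\zeta e^{it})=\{\zeta e^{i\theta}:|\theta|<t\}$. *)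

theory Defs
  imports "HOL-Probability.Probability"
begin

abbreviation unit_circle :: "complex set" where
  "unit_circle \<equiv> sphere 0 1"

abbreviation circle_borel :: "complex measure" where
  "circle_borel \<equiv> restrict_space borel unit_circle"

text \<open>The measure \<open>dt / (2 * pi)\<close>, carried to the unit circle by \<open>t \<mapsto> exp (i t)\<close>.\<close>

definition circle_measure :: "complex measure" where
  "circle_measure = distr (uniform_measure lborel {0..<2*pi}) circle_borel cis"

text \<open>Elements of \<open>L^2\<close> are represented by functions; everything below depends only on the
  almost-everywhere class of the function. Values off the unit circle are irrelevant.\<close>

definition L2_circle :: "(complex \<Rightarrow> complex) set" where
  "L2_circle = {f. f \<in> borel_measurable circle_measure \<and>
      (\<integral>\<^sup>+ w. ennreal ((norm (f w))\<^sup>2) \<partial>circle_measure) < \<infinity>}"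

definition poisson_integral :: "(complex \<Rightarrow> complex) \<Rightarrow> complex \<Rightarrow> complex" where
  "poisson_integral f z =
     (LINT w|circle_measure. of_real ((1 - (norm z)\<^sup>2) / (norm (w - z))\<^sup>2) * f w)"

definition stolz_region :: "real \<Rightarrow> complex \<Rightarrow> complex set" where
  "stolz_region \<kappa> \<xi> = {z. norm z < 1 \<and> norm (z - \<xi>) < \<kappa> * (1 - norm z)}"

definition has_nontangential_limit ::
    "(complex \<Rightarrow> complex) \<Rightarrow> complex \<Rightarrow> complex \<Rightarrow> bool" where
  "has_nontangential_limit g L \<xi> \<longleftrightarrow>
     (\<forall>\<kappa>>1. (g \<longlongrightarrow> L) (at \<xi> within stolz_region \<kappa> \<xi>))"

definition boundary_value :: "(complex \<Rightarrow> complex) \<Rightarrow> complex \<Rightarrow> complex" where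
  "boundary_value f \<xi> = (THE L. has_nontangential_limit (poisson_integral f) L \<xi>)"

definition local_dirichlet :: "(complex \<Rightarrow> complex) \<Rightarrow> complex \<Rightarrow> ennreal" where
  "local_dirichlet f \<xi> =
     (if \<exists>L. has_nontangential_limit (poisson_integral f) L \<xi>
      then \<integral>\<^sup>+ w. ennreal ((norm (f w - boundary_value f \<xi>))\<^sup>2 / (norm (w - \<xi>))\<^sup>2) \<partial>circle_measure
      else \<infinity>)"

definition dirichlet_integral :: "complex measure \<Rightarrow> (complex \<Rightarrow> complex) \<Rightarrow> ennreal" where
  "dirichlet_integral \<mu> f = (\<integral>\<^sup>+ \<xi>. local_dirichlet f \<xi> \<partial>\<mu>)"

definition dirichlet_norm_sq :: "complex measure \<Rightarrow> (complex \<Rightarrow> complex) \<Rightarrow> ennreal" where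
  "dirichlet_norm_sq \<mu> f =
     (\<integral>\<^sup>+ w. ennreal ((norm (f w))\<^sup>2) \<partial>circle_measure) + dirichlet_integral \<mu> f"

definition harmonic_dirichlet_space :: "complex measure \<Rightarrow> (complex \<Rightarrow> complex) set" where
  "harmonic_dirichlet_space \<mu> = {f \<in> L2_circle. dirichlet_norm_sq \<mu> f < \<infinity>}"

definition open_capacity :: "complex measure \<Rightarrow> complex set \<Rightarrow> ennreal" where
  "open_capacity \<mu> U = Inf {dirichlet_norm_sq \<mu> u | u.
      u \<in> harmonic_dirichlet_space \<mu> \<and>
      (AE w in circle_measure. u w \<in> \<real> \<and> 0 \<le> Re (u w)) \<and>
      (AE w in circle_measure. w \<in> U \<longrightarrow> 1 \<le> Re (u w))}"

definition capacity :: "complex measure \<Rightarrow> complex set \<Rightarrow> ennreal" where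
  "capacity \<mu> F = Inf {open_capacity \<mu> U | U. openin (top_of_set unit_circle) U \<and> F \<subseteq> U}"

definition circle_arc :: "complex \<Rightarrow> real \<Rightarrow> complex set" where
  "circle_arc \<zeta> t = {\<zeta> * cis \<theta> | \<theta>. \<bar>\<theta>\<bar> < t}"

text \<open>The supremum is taken in \<open>ennreal\<close>, so that it is \<open>0\<close> for empty \<open>E\<close>; it is finite whenever
  the measure is finite.\<close>

definition arc_modulus :: "complex measure \<Rightarrow> complex set \<Rightarrow> real \<Rightarrow> real" where
  "arc_modulus \<mu> E t = enn2real (SUP \<zeta>\<in>E. emeasure \<mu> (circle_arc \<zeta> t))"

end

(* Test the capacity of E with u_a(w) = min 1 (2 - a * dist(w, E))^+ as a tends to infinity.
   If r = dist(xi, E) > 0, then |u_a(w) - u_a(xi)| is at most min(1, 4 |w - xi| / r) for every a,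
   and comparison with a Poisson kernel bounds the local Dirichlet integral of u_a at xi by 16 / r.
   A cover of the s-neighbourhood of E by O(1/s) arcs shows that its mu-measure is O(s^(alpha - 1)),
   so that mu(E) = 0 and, since alpha > 2, the function 1/dist(., E) is mu-integrable.
   As u_a tends to 0 off the null set E, dominated convergence gives ||u_a||_mu --> 0. *)
theory Submission
  imports Defs "HOL-Complex_Analysis.Complex_Analysis"
begin

text \<open>The kernel \<open>1 / |w - \<xi>|^2\<close> is not integrable on the circle, and the
  Lipschitz constant a of the test functions blows up, so dominated convergence needs a majorant
  free of a at two levels: in w for fixed \<open>\<xi>\<close>, and then in \<open>\<xi>\<close>.
  Both come from one observation. With \<open>k = r / 4\<close>, the quotient
  \<open>min(1, y / k)^2 / y^2\<close> at \<open>y = |w - \<xi>|\<close> is comparable to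
  \<open>1 / (y + k)^2\<close>, hence to \<open>1 / |w - z|^2\<close> with the pole moved inside the
  disc to \<open>z = (1 - k) \<xi>\<close>. Its integral is exactly \<open>1 / (1 - |z|^2)\<close>,
  at most \<open>1 / k\<close>; the comparison costs a factor 4, and \<open>4 / k = 16 / r\<close>.
  The exponent 2 is the sum of two losses of one power of s: the number of covering arcs, and the
  weight \<open>1 / dist(., E)\<close>. Since the local integral is defined through non-tangential
  limits of Poisson integrals, it must also be shown that these limits are the point values of the
  test functions. Lipschitz continuity gives this with an explicit rate.\<close>

section \<open>Normalised arc length and the mass of the Poisson kernel\<close>

lemma space_circle_measure [simp]: "space circle_measure = unit_circle"
  by (simp add: circle_measure_def space_restrict_space)

lemma sets_circle_measure [measurable_cong]: "sets circle_measure = sets circle_borel"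
  by (simp add: circle_measure_def)

lemma borel_measurable_cis [measurable]: "cis \<in> borel_measurable borel"
  by (intro borel_measurable_continuous_onI continuous_intros)

lemma measurable_cis_circle: "cis \<in> measurable (uniform_measure lborel {0..<2*pi}) circle_borel"
  by (intro measurable_restrict_space2) auto

lemma prob_space_circle_measure: "prob_space circle_measure"
  unfolding circle_measure_def
  by (intro prob_space.prob_space_distr prob_space_uniform_measure measurable_cis_circle) auto

text \<open>The closed interval matches the parametrisation of contour integrals; the added endpoint
  is a null set.\<close>

lemma nn_integral_circle_measure:
  assumes "f \<in> borel_measurable borel"
  shows "(\<integral>\<^sup>+ w. f w \<partial>circle_measure)
    = (\<integral>\<^sup>+ t. f (cis t) * indicator {0..2*pi} t \<partial>lborel) / ennreal (2*pi)"
proof -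
  note [measurable] = assms
  have "f \<in> borel_measurable circle_borel"
    by (intro measurable_restrict_space1 assms)
  then have "(\<integral>\<^sup>+ w. f w \<partial>circle_measure)
      = (\<integral>\<^sup>+ t. f (cis t) \<partial>uniform_measure lborel {0..<2*pi})"
    unfolding circle_measure_def by (intro nn_integral_distr measurable_cis_circle) simp
  also have "\<dots> = (\<integral>\<^sup>+ t. f (cis t) * indicator {0..<2*pi} t \<partial>lborel) / ennreal (2*pi)"
    by (subst nn_integral_uniform_measure) auto
  also have "(\<integral>\<^sup>+ t. f (cis t) * indicator {0..<2*pi} t \<partial>lborel)
      = (\<integral>\<^sup>+ t. f (cis t) * indicator {0..2*pi} t \<partial>lborel)"
    using AE_lborel_singleton[of "2*pi"]
    by (intro nn_integral_cong_AE) (auto elim!: eventually_mono split: split_indicator)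
  finally show ?thesis .
qed

text \<open>Cauchy's integral formula at \<open>z\<close> for a function holomorphic near the closed
  disc's points and equal to 1 at \<open>z\<close>.\<close>

lemma poisson_kernel_has_integral:
  assumes z: "norm z < 1"
  shows "((\<lambda>t. (1 - (norm z)\<^sup>2) / (norm (cis t - z))\<^sup>2) has_integral 2*pi) {0..2*pi}"
proof -
  have nz: "1 - cnj z * w \<noteq> 0" if "w \<in> cball 0 1" for w
  proof
    assume "1 - cnj z * w = 0"
    then have "1 = norm z * norm w"
      by (metis complex_mod_cnj eq_iff_diff_eq_0 norm_mult norm_one)
    also have "\<dots> \<le> norm z * 1"
      using that by (intro mult_left_mono) auto
    finally show False using z by simp
  qed
  \<comment> \<open>On the circle \<open>cnj w = 1 / w\<close>, so the kernel times \<open>\<i> dt\<close> is \<open>g w / (w - z) dw\<close>.\<close>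
  define g where "g = (\<lambda>w. (1 - z * cnj z) / (1 - cnj z * w))"
  have "g holomorphic_on cball 0 1"
    unfolding g_def using nz by (intro holomorphic_intros) auto
  then have "((\<lambda>u. g u / (u - z)) has_contour_integral (2*pi*\<i> * g z)) (circlepath 0 1)"
    using z Cauchy_integral_circlepath_simple[of g 0 1 z] by simp
  moreover have "g z = 1"
    using nz[of z] z by (simp add: g_def mult.commute)
  ultimately have "((\<lambda>t. g (cis t) / (cis t - z) * \<i> * cis t) has_integral 2*pi*\<i>) {0..2*pi}"
    unfolding circlepath_def by (simp add: has_contour_integral_part_circlepath_iff)
  \<comment> \<open>The contour integrand is \<open>\<i>\<close> times the real kernel, so its
    imaginary part is the kernel itself.\<close>
  then have "((\<lambda>t. Im (g (cis t) / (cis t - z) * \<i> * cis t)) has_integral Im (2*pi*\<i>)) {0..2*pi}"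
    by (rule has_integral_linear[OF _ bounded_linear_Im, unfolded o_def])
  moreover have "g (cis t) / (cis t - z) * \<i> * cis t
      = \<i> * of_real ((1 - (norm z)\<^sup>2) / (norm (cis t - z))\<^sup>2)" for t
  proof -
    have 1: "cis t \<noteq> z" using z by auto
    have 2: "1 - cnj z * cis t \<noteq> 0" by (intro nz) auto
    have c: "cis t * cnj (cis t) = 1"
      by (simp add: cis_cnj cis_mult)
    \<comment> \<open>On the circle \<open>1 - cnj z * w = w * cnj (w - z)\<close>, which turns the
      product of the two denominators into \<open>w * |w - z|^2\<close>.\<close>
    have "(cis t - z) * (1 - cnj z * cis t) = cis t * ((cis t - z) * cnj (cis t - z))"
      using c by (simp add: algebra_simps)
    then have 3: "(cis t - z) * (1 - cnj z * cis t) = cis t * of_real ((norm (cis t - z))\<^sup>2)"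
      by (simp only: complex_norm_square)
    have "g (cis t) / (cis t - z) * \<i> * cis t
        = \<i> * cis t * (1 - z * cnj z) / ((cis t - z) * (1 - cnj z * cis t))"
      using 1 2 by (simp add: g_def field_simps)
    also have "\<dots> = \<i> * of_real ((1 - (norm z)\<^sup>2) / (norm (cis t - z))\<^sup>2)"
      unfolding 3 using 1 by (simp add: field_simps flip: complex_norm_square)
    finally show ?thesis .
  qed
  ultimately show ?thesis
    by simp
qed

lemma nn_integral_inverse_square:
  assumes z: "norm z < 1"
  shows "(\<integral>\<^sup>+ w. ennreal (1 / (norm (w - z))\<^sup>2) \<partial>circle_measure) = ennreal (1 / (1 - (norm z)\<^sup>2))"
proof -
  have pos: "1 - (norm z)\<^sup>2 > 0"
    using z by (simp add: power_less_one_iff abs_square_less_1)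
  let ?f = "\<lambda>t. 1 / (norm (cis t - z))\<^sup>2 * indicator {0..2*pi} t"
  have "((\<lambda>t. inverse (1 - (norm z)\<^sup>2) * ((1 - (norm z)\<^sup>2) / (norm (cis t - z))\<^sup>2))
      has_integral inverse (1 - (norm z)\<^sup>2) * (2*pi)) {0..2*pi}"
    by (intro has_integral_mult_right poisson_kernel_has_integral z)
  then have "((\<lambda>t. 1 / (norm (cis t - z))\<^sup>2) has_integral 2*pi / (1 - (norm z)\<^sup>2)) {0..2*pi}"
    using pos by (simp add: divide_simps mult.commute)
  then have "(?f has_integral 2*pi / (1 - (norm z)\<^sup>2)) UNIV"
    unfolding has_integral_restrict_UNIV[symmetric, of _ _ "{0..2*pi}"]
    by (rule has_integral_cong[THEN iffD1, rotated]) (simp add: indicator_def)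
  then have *: "(\<integral>\<^sup>+ t. ennreal (?f t) \<partial>lborel) = ennreal (2*pi / (1 - (norm z)\<^sup>2))"
    by (intro nn_integral_has_integral_lborel) auto
  have "(\<integral>\<^sup>+ w. ennreal (1 / (norm (w - z))\<^sup>2) \<partial>circle_measure)
      = (\<integral>\<^sup>+ t. ennreal (1 / (norm (cis t - z))\<^sup>2) * indicator {0..2*pi} t \<partial>lborel) / ennreal (2*pi)"
    by (intro nn_integral_circle_measure) measurable
  also have "(\<integral>\<^sup>+ t. ennreal (1 / (norm (cis t - z))\<^sup>2) * indicator {0..2*pi} t \<partial>lborel)
      = (\<integral>\<^sup>+ t. ennreal (?f t) \<partial>lborel)"
    by (intro nn_integral_cong) (auto split: split_indicator)
  finally show ?thesis
    unfolding * using pos by (simp add: divide_ennreal)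
qed

lemma norm_diff_on_circle_pos: "norm z < 1 \<Longrightarrow> w \<in> unit_circle \<Longrightarrow> norm (w - z) > 0" for w z :: complex
  by auto

lemma borel_measurable_circle_measure_continuous:
  "continuous_on unit_circle f \<Longrightarrow> f \<in> borel_measurable circle_measure" for f :: "complex \<Rightarrow> 'a::topological_space"
  using borel_measurable_continuous_on_restrict[of unit_circle f]
  by (simp add: measurable_cong_sets[OF sets_circle_measure refl])

lemma integrable_continuous_circle:
  fixes f :: "complex \<Rightarrow> 'a::{second_countable_topology,banach}"
  assumes "continuous_on unit_circle f"
  shows "integrable circle_measure f"
proof -
  interpret prob_space circle_measure by (rule prob_space_circle_measure)
  have "bounded (f ` unit_circle)"
    by (intro compact_imp_bounded compact_continuous_image assms) simp
  then obtain B where "norm (f w) \<le> B" if "w \<in> unit_circle" for w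
    unfolding bounded_iff by blast
  then show ?thesis
    by (intro integrable_const_bound[of _ B] borel_measurable_circle_measure_continuous assms AE_I2) auto
qed

lemma integral_poisson_kernel:
  assumes z: "norm z < 1"
  shows "(LINT w|circle_measure. (1 - (norm z)\<^sup>2) / (norm (w - z))\<^sup>2) = 1"
proof -
  have pos: "1 - (norm z)\<^sup>2 > 0"
    using z by (simp add: power_less_one_iff abs_square_less_1)
  have "(LINT w|circle_measure. 1 / (norm (w - z))\<^sup>2) = 1 / (1 - (norm z)\<^sup>2)"
    using nn_integral_inverse_square[OF z] pos norm_diff_on_circle_pos[OF z]
    by (subst integral_eq_nn_integral) (auto intro!: borel_measurable_circle_measure_continuous continuous_intros)
  then have "(LINT w|circle_measure. (1 - (norm z)\<^sup>2) * (1 / (norm (w - z))\<^sup>2)) = 1"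
    using pos by (subst integral_mult_right_zero) auto
  then show ?thesis by simp
qed

section \<open>Boundary values of Lipschitz functions\<close>

text \<open>The kernel \<open>P\<close> has mass 1, so the difference is a \<open>P\<close>-average
  of \<open>u w - u \<xi>\<close>, and \<open>|w - \<xi>| \<le> |w - z| + |z - \<xi>|\<close>. The
  \<open>P\<close>-average of \<open>|w - z|\<close> is at most \<open>s = sqrt (1 - |z|^2)\<close>:
  the pointwise bound \<open>P w * |w - z| \<le> (s + s * P w) / 2\<close> integrates to
  \<open>s / 2 + s / 2\<close>.\<close>

lemma norm_poisson_integral_diff_le:
  fixes u :: "complex \<Rightarrow> complex"
  assumes L: "L-lipschitz_on unit_circle u" and \<xi>: "\<xi> \<in> unit_circle" and z: "norm z < 1"
  shows "norm (poisson_integral u z - u \<xi>) \<le> L * (sqrt (1 - (norm z)\<^sup>2) + norm (z - \<xi>))"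
proof -
  interpret prob_space circle_measure by (rule prob_space_circle_measure)
  define s where "s = sqrt (1 - (norm z)\<^sup>2)"
  have pos: "1 - (norm z)\<^sup>2 > 0"
    using z by (simp add: power_less_one_iff abs_square_less_1)
  have s: "s > 0" "s\<^sup>2 = 1 - (norm z)\<^sup>2"
    using pos by (auto simp: s_def)
  have L0: "L \<ge> 0" using L by (rule lipschitz_on_nonneg)
  have cu: "continuous_on unit_circle u" using L by (rule lipschitz_on_continuous_on)
  define P where "P = (\<lambda>w. s\<^sup>2 / (norm (w - z))\<^sup>2)"
  have cP: "continuous_on unit_circle P"
    unfolding P_def using norm_diff_on_circle_pos[OF z] by (intro continuous_intros) auto
  have iP: "integrable circle_measure P"
    by (intro integrable_continuous_circle cP)
  have P1: "(LINT w|circle_measure. P w) = 1"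
    using integral_poisson_kernel[OF z] by (simp add: P_def s)
  have P1': "(LINT w|circle_measure. of_real (P w) * u \<xi>) = u \<xi>"
    using P1 by (simp only: integral_mult_left_zero integral_complex_of_real of_real_1 mult_1)
  have "poisson_integral u z - u \<xi>
      = (LINT w|circle_measure. of_real (P w) * u w) - (LINT w|circle_measure. of_real (P w) * u \<xi>)"
    unfolding P1' by (simp only: poisson_integral_def P_def s)
  also have "\<dots> = (LINT w|circle_measure. of_real (P w) * u w - of_real (P w) * u \<xi>)"
    by (intro Bochner_Integration.integral_diff[symmetric] integrable_continuous_circle
        continuous_intros cu cP)
  also have "norm \<dots> \<le> (LINT w|circle_measure. norm (of_real (P w) * u w - of_real (P w) * u \<xi>))"
    by (rule integral_norm_bound)
  also have "\<dots> \<le> (LINT w|circle_measure. L * ((s + s * P w) / 2 + norm (z - \<xi>) * P w))"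
  proof (intro integral_mono integrable_continuous_circle continuous_intros cu cP)
    fix w assume "w \<in> space circle_measure"
    then have w: "w \<in> unit_circle" by simp
    define x where "x = norm (w - z)"
    have x: "x > 0" using norm_diff_on_circle_pos[OF z w] by (simp add: x_def)
    \<comment> \<open>AM-GM: \<open>s\<^sup>2 / x \<le> (s + s\<^sup>3 / x\<^sup>2) / 2\<close>\<close>
    have "s * (x - s)\<^sup>2 \<ge> 0" using s by simp
    then have "s\<^sup>2 / x\<^sup>2 * x \<le> (s + s * (s\<^sup>2 / x\<^sup>2)) / 2"
      using x by (simp add: field_simps power2_eq_square)
    then have 1: "P w * x \<le> (s + s * P w) / 2" by (simp add: P_def x_def)
    have P0: "P w \<ge> 0" by (simp add: P_def)
    have "norm (of_real (P w) * u w - of_real (P w) * u \<xi>) = P w * norm (u w - u \<xi>)"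
      using P0 by (simp add: norm_mult flip: right_diff_distrib)
    also have "\<dots> \<le> P w * (L * (x + norm (z - \<xi>)))"
    proof (intro mult_left_mono P0)
      have "norm (u w - u \<xi>) \<le> L * norm (w - \<xi>)"
        using lipschitz_onD[OF L w \<xi>] by (simp add: dist_norm)
      also have "\<dots> \<le> L * (x + norm (z - \<xi>))"
        unfolding x_def using norm_triangle_ineq[of "w - z" "z - \<xi>"]
        by (intro mult_left_mono L0) simp
      finally show "norm (u w - u \<xi>) \<le> L * (x + norm (z - \<xi>))" .
    qed
    also have "\<dots> = L * (P w * x + norm (z - \<xi>) * P w)"
      by (simp add: algebra_simps)
    also have "\<dots> \<le> L * ((s + s * P w) / 2 + norm (z - \<xi>) * P w)"
      using 1 by (intro mult_left_mono L0) simp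
    finally show "norm (of_real (P w) * u w - of_real (P w) * u \<xi>)
        \<le> L * ((s + s * P w) / 2 + norm (z - \<xi>) * P w)" .
  qed auto
  also have "\<dots> = L * (s + norm (z - \<xi>))"
    using iP prob_space by (simp add: P1)
  finally show ?thesis by (simp add: s_def)
qed

text \<open>The preceding bound tends to 0 along every approach to \<open>\<xi>\<close> from inside
  the disc, in particular within each Stolz region.\<close>

lemma has_nontangential_limit_lipschitz:
  assumes L: "L-lipschitz_on unit_circle u" and \<xi>: "\<xi> \<in> unit_circle"
  shows "has_nontangential_limit (poisson_integral u) (u \<xi>) \<xi>"
  unfolding has_nontangential_limit_def
proof (intro allI impI)
  fix \<kappa> :: real
  let ?F = "at \<xi> within stolz_region \<kappa> \<xi>"
  have "((\<lambda>z. L * (sqrt (1 - (norm z)\<^sup>2) + norm (z - \<xi>)))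
      \<longlongrightarrow> L * (sqrt (1 - (norm \<xi>)\<^sup>2) + norm (\<xi> - \<xi>))) ?F"
    by (intro tendsto_intros)
  then have "((\<lambda>z. L * (sqrt (1 - (norm z)\<^sup>2) + norm (z - \<xi>))) \<longlongrightarrow> 0) ?F"
    using \<xi> by simp
  moreover have "\<forall>\<^sub>F z in ?F. norm (poisson_integral u z - u \<xi>)
      \<le> L * (sqrt (1 - (norm z)\<^sup>2) + norm (z - \<xi>))"
    using norm_poisson_integral_diff_le[OF assms]
    by (auto simp: eventually_at_topological stolz_region_def)
  ultimately have "((\<lambda>z. poisson_integral u z - u \<xi>) \<longlongrightarrow> 0) ?F"
    by (rule Lim_null_comparison[rotated])
  then show "(poisson_integral u \<longlongrightarrow> u \<xi>) ?F"
    by (rule LIM_zero_cancel)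
qed

text \<open>Radial points \<open>(1 - h) \<xi>\<close> satisfy
  \<open>|z - \<xi>| = 1 - |z| = h\<close>, so they lie in the region as soon as
  \<open>\<kappa> > 1\<close>. This makes the filter within the region nontrivial; without it limits
  would not be unique and the \<open>THE\<close> in \<open>boundary_value\<close> would not be
  determined.\<close>

lemma islimpt_stolz_region:
  assumes \<xi>: "\<xi> \<in> unit_circle" and \<kappa>: "\<kappa> > 1"
  shows "\<xi> islimpt stolz_region \<kappa> \<xi>"
  unfolding islimpt_approachable
proof (intro allI impI)
  fix e :: real assume e: "e > 0"
  define h where "h = min (e / 2) (1 / 2)"
  have h: "h > 0" "h \<le> 1 / 2" "h < e" using e by (auto simp: h_def)
  have 1: "norm (of_real (1 - h) * \<xi>) = 1 - h"
    using \<xi> h unfolding norm_mult norm_of_real by simp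
  have "of_real (1 - h) * \<xi> - \<xi> = of_real (- h) * \<xi>" by (simp add: algebra_simps)
  then have 2: "norm (of_real (1 - h) * \<xi> - \<xi>) = h"
    using \<xi> h by (simp only: norm_mult norm_of_real) simp
  have "of_real (1 - h) * \<xi> \<in> stolz_region \<kappa> \<xi>"
    unfolding stolz_region_def mem_Collect_eq 1 2 using h \<kappa> by simp
  moreover have "of_real (1 - h) * \<xi> \<noteq> \<xi>" using 2 h by auto
  moreover have "dist (of_real (1 - h) * \<xi>) \<xi> < e" using 2 h by (simp only: dist_norm)
  ultimately show "\<exists>z\<in>stolz_region \<kappa> \<xi>. z \<noteq> \<xi> \<and> dist z \<xi> < e" by blast
qed

lemma has_nontangential_limit_unique:
  assumes "\<xi> \<in> unit_circle" "has_nontangential_limit g a \<xi>" "has_nontangential_limit g b \<xi>"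
  shows "a = b"
proof (rule tendsto_unique[where f = g])
  show "at \<xi> within stolz_region 2 \<xi> \<noteq> bot"
    using islimpt_stolz_region[of \<xi> 2] assms(1) by (simp add: trivial_limit_within)
qed (use assms in \<open>auto simp: has_nontangential_limit_def\<close>)

lemma local_dirichlet_lipschitz:
  assumes "L-lipschitz_on unit_circle u" and "\<xi> \<in> unit_circle"
  shows "local_dirichlet u \<xi>
    = (\<integral>\<^sup>+ w. ennreal ((norm (u w - u \<xi>))\<^sup>2 / (norm (w - \<xi>))\<^sup>2) \<partial>circle_measure)"
proof -
  have *: "has_nontangential_limit (poisson_integral u) (u \<xi>) \<xi>"
    using assms by (rule has_nontangential_limit_lipschitz)
  have "boundary_value u \<xi> = u \<xi>"
    unfolding boundary_value_def
    using * has_nontangential_limit_unique[OF assms(2)] by (intro the_equality)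
  with * show ?thesis by (auto simp: local_dirichlet_def)
qed

section \<open>Comparison of difference quotients with a kernel whose pole lies inside the
  disc\<close>

text \<open>To be read with \<open>d = |u w - u \<xi>|\<close>, \<open>y = |w - \<xi>|\<close> and
  \<open>p\<close> the distance from \<open>w\<close> to \<open>(1 - k) \<xi>\<close>. Then
  \<open>d * p \<le> d * y + d * k\<close>, where the first term is at most \<open>y\<close> by
  \<open>d \<le> 1\<close> and the second by \<open>d \<le> y / k\<close>. For \<open>y = 0\<close>
  the left side is 0 by the convention on division.\<close>

lemma difference_quotient_le:
  fixes d y k p :: real
  assumes "0 \<le> d" "d \<le> 1" "d \<le> y / k" "0 < k" "0 < p" "p \<le> y + k" "0 \<le> y"
  shows "d\<^sup>2 / y\<^sup>2 \<le> 4 / p\<^sup>2"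
proof (cases "y = 0")
  case False
  then have y: "y > 0" using assms by simp
  have "d * p \<le> 2 * y"
  proof -
    have "d * p \<le> d * (y + k)" using assms by (intro mult_left_mono) auto
    also have "\<dots> = d * y + d * k" by (simp add: algebra_simps)
    also have "\<dots> \<le> 1 * y + y"
      using assms by (intro add_mono mult_right_mono) (auto simp: pos_le_divide_eq)
    finally show ?thesis by simp
  qed
  then have "d / y \<le> 2 / p"
    using y assms by (simp add: field_simps)
  then have "(d / y)\<^sup>2 \<le> (2 / p)\<^sup>2"
    using y assms by (intro power_mono) auto
  then show ?thesis by (simp add: power_divide)
qed auto

text \<open>The exact value is \<open>4 / (1 - (1 - k)^2)\<close>, and
  \<open>1 - (1 - k)^2 = k + (k - k^2)\<close> is at least \<open>k\<close> for
  \<open>k \<le> 1\<close>.\<close>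

lemma nn_integral_shifted_inverse_square_le:
  fixes k :: real
  assumes \<xi>: "\<xi> \<in> unit_circle" and k: "0 < k" "k \<le> 1"
  shows "(\<integral>\<^sup>+ w. ennreal (4 / (norm (w - of_real (1 - k) * \<xi>))\<^sup>2) \<partial>circle_measure) \<le> ennreal (4 / k)"
proof -
  have n: "norm (of_real (1 - k) * \<xi>) = 1 - k"
    using \<xi> k unfolding norm_mult norm_of_real by simp
  have "(\<integral>\<^sup>+ w. ennreal (4 / (norm (w - of_real (1 - k) * \<xi>))\<^sup>2) \<partial>circle_measure)
      = (\<integral>\<^sup>+ w. 4 * ennreal (1 / (norm (w - of_real (1 - k) * \<xi>))\<^sup>2) \<partial>circle_measure)"
    by (intro nn_integral_cong) (simp flip: ennreal_mult' ennreal_numeral)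
  also have "\<dots> = 4 * ennreal (1 / (1 - (1 - k)\<^sup>2))"
    using k n nn_integral_inverse_square[of "of_real (1 - k) * \<xi>"]
    by (subst nn_integral_cmult) (auto simp del: of_real_diff intro: measurable_restrict_space1
        simp: measurable_cong_sets[OF sets_circle_measure refl])
  also have "\<dots> = ennreal (4 / (1 - (1 - k)\<^sup>2))"
    by (simp flip: ennreal_mult' ennreal_numeral)
  also have "\<dots> \<le> ennreal (4 / k)"
  proof -
    have "k * k \<le> k * 1" using k by (intro mult_left_mono) auto
    then have "k \<le> 1 - (1 - k)\<^sup>2" by (simp add: power2_eq_square algebra_simps)
    then show ?thesis using k by (intro ennreal_leI divide_left_mono mult_pos_pos) auto
  qed
  finally show ?thesis .
qed

section \<open>The test functions\<close>

text \<open>The plateau of height 1 extends to distance \<open>1 / a\<close> from \<open>E\<close>,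
  because a competitor for the capacity must be at least 1 on an open set around \<open>E\<close>;
  the support ends at distance \<open>2 / a\<close>.\<close>

definition bump :: "complex set \<Rightarrow> real \<Rightarrow> complex \<Rightarrow> real" where
  "bump E a w = max 0 (min 1 (2 - a * infdist w E))"

lemma bump_bounds: "0 \<le> bump E a w" "bump E a w \<le> 1"
  by (auto simp: bump_def)

lemma bump_eq_1: "a * infdist w E \<le> 1 \<Longrightarrow> bump E a w = 1"
  by (auto simp: bump_def)

lemma bump_eq_0: "2 \<le> a * infdist w E \<Longrightarrow> bump E a w = 0"
  by (auto simp: bump_def)

lemma bump_diff_le: "0 \<le> a \<Longrightarrow> \<bar>bump E a w - bump E a \<xi>\<bar> \<le> a * dist w \<xi>"
proof -
  assume a: "0 \<le> a"
  have "\<bar>bump E a w - bump E a \<xi>\<bar> \<le> \<bar>a * infdist w E - a * infdist \<xi> E\<bar>"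
    by (auto simp: bump_def)
  also have "\<dots> = a * \<bar>infdist w E - infdist \<xi> E\<bar>"
    using a by (simp add: abs_mult flip: right_diff_distrib)
  also have "\<dots> \<le> a * dist w \<xi>"
    using a by (intro mult_left_mono infdist_triangle_abs)
  finally show ?thesis .
qed

text \<open>Let r be the distance from \<open>\<xi>\<close> to \<open>E\<close>. If
  \<open>a * r < 4\<close>, the Lipschitz constant \<open>a\<close> is below \<open>4 / r\<close>.
  Otherwise \<open>\<xi>\<close> lies outside the support, and a point \<open>w\<close> with a
  nonzero value is within \<open>2 / a \<le> r / 2\<close> of \<open>E\<close>, hence at distance
  more than \<open>r / 2\<close> from \<open>\<xi>\<close>; the right side then exceeds the trivial
  bound 1.\<close>

lemma bump_diff_le_infdist:
  assumes a: "0 \<le> a" and r: "infdist \<xi> E > 0"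
  shows "\<bar>bump E a w - bump E a \<xi>\<bar> \<le> dist w \<xi> / (infdist \<xi> E / 4)"
proof (cases "a * infdist \<xi> E < 4")
  case True
  have "\<bar>bump E a w - bump E a \<xi>\<bar> \<le> a * dist w \<xi>" using a by (rule bump_diff_le)
  also have "\<dots> \<le> (4 / infdist \<xi> E) * dist w \<xi>"
    using True r by (intro mult_right_mono) (auto simp: field_simps)
  finally show ?thesis by (simp add: mult.commute)
next
  case False
  show ?thesis
  proof (cases "2 \<le> a * infdist w E")
    case True
    then show ?thesis using False r by (simp add: bump_eq_0)
  next
    case F: False
    have "a > 0" using False a by (cases "a = 0") auto
    have "a * (2 * infdist w E) < a * infdist \<xi> E" using F False by simp
    then have "2 * infdist w E < infdist \<xi> E" using \<open>a > 0\<close> by simp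
    moreover have "infdist \<xi> E \<le> infdist w E + dist w \<xi>"
      using infdist_triangle[of \<xi> E w] by (simp add: dist_commute)
    ultimately have "1 \<le> dist w \<xi> / (infdist \<xi> E / 4)"
      using r by (simp add: field_simps)
    moreover have "\<bar>bump E a w - bump E a \<xi>\<bar> \<le> 1"
      using bump_bounds[of E a w] bump_bounds[of E a \<xi>] by linarith
    ultimately show ?thesis by linarith
  qed
qed

section \<open>Arcs and the measure of neighbourhoods of \<open>E\<close>\<close>

text \<open>The open arc is a countable union of compact ones, of half-widths
  \<open>t - 1 / (n + 1)\<close>.\<close>

lemma sets_circle_arc:
  assumes \<zeta>: "\<zeta> \<in> unit_circle"
  shows "circle_arc \<zeta> t \<in> sets circle_borel"
proof -
  let ?K = "\<lambda>n. (\<lambda>\<theta>. \<zeta> * cis \<theta>) ` {-(t - inverse (real (Suc n)))..t - inverse (real (Suc n))}"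
  have "circle_arc \<zeta> t = (\<Union>n. ?K n)"
  proof (intro set_eqI iffI)
    fix w assume "w \<in> circle_arc \<zeta> t"
    then obtain \<theta> where \<theta>: "w = \<zeta> * cis \<theta>" "\<bar>\<theta>\<bar> < t" by (auto simp: circle_arc_def)
    then obtain n where "inverse (real (Suc n)) < t - \<bar>\<theta>\<bar>"
      using reals_Archimedean[of "t - \<bar>\<theta>\<bar>"] by auto
    then have "\<theta> \<in> {-(t - inverse (real (Suc n)))..t - inverse (real (Suc n))}" by auto
    then show "w \<in> (\<Union>n. ?K n)" unfolding \<theta>(1) by blast
  next
    fix w assume "w \<in> (\<Union>n. ?K n)"
    then obtain n \<theta> where "w = \<zeta> * cis \<theta>" "\<theta> \<in> {-(t - inverse (real (Suc n)))..t - inverse (real (Suc n))}"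
      by blast
    moreover have "inverse (real (Suc n)) > 0" by simp
    ultimately show "w \<in> circle_arc \<zeta> t" unfolding circle_arc_def atLeastAtMost_iff
      by (intro CollectI exI[of _ \<theta>]) linarith
  qed
  moreover have "closed (?K n)" for n
    by (intro compact_imp_closed compact_continuous_image continuous_intros) auto
  then have "(\<Union>n. ?K n) \<in> sets borel" by (intro sets.countable_UN) auto
  moreover have "circle_arc \<zeta> t \<subseteq> unit_circle"
    using \<zeta> by (auto simp: circle_arc_def norm_mult)
  ultimately show ?thesis by (simp add: sets_restrict_space_iff)
qed

text \<open>A weak form of Jordan's inequality: the Taylor error is at most \<open>x^3 / 6\<close>,
  and \<open>x^2 \<le> 3\<close> on this range makes that at most \<open>x / 2\<close>.\<close>

lemma half_le_sin: "0 \<le> x \<Longrightarrow> x \<le> pi / 2 \<Longrightarrow> x / 2 \<le> sin x" for x :: real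
proof -
  assume x: "0 \<le> x" "x \<le> pi / 2"
  have "pi < 3.4" by (rule le_less_trans[OF pi_approx(2)]) simp
  then have "x < 1.7" using x by simp
  then have "x\<^sup>2 \<le> 1.7\<^sup>2" using x by (intro power_mono) auto
  then have "x * x\<^sup>2 \<le> x * 3" using x by (intro mult_left_mono) (auto simp: power2_eq_square)
  then have 1: "x^3 \<le> 3 * x" by (simp add: power3_eq_cube power2_eq_square)
  have "\<bar>sin x - (\<Sum>m<3. sin_coeff m * x ^ m)\<bar> \<le> inverse (fact 3) * \<bar>x\<bar> ^ 3"
    by (rule Maclaurin_sin_bound)
  then have "\<bar>sin x - x\<bar> \<le> x^3 / 6"
    using x by (simp add: eval_nat_numeral sin_coeff_def)
  then show ?thesis using 1 by linarith
qed

lemma norm_cis_minus_1: "norm (cis t - 1) = 2 * \<bar>sin (t / 2)\<bar>"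
proof (rule power2_eq_imp_eq)
  have "(norm (cis t - 1))\<^sup>2 = (cos t - 1)\<^sup>2 + (sin t)\<^sup>2"
    by (simp add: cmod_power2)
  also have "\<dots> = 2 - 2 * cos (2 * (t / 2))"
    using sin_cos_squared_add[of t] by (simp add: power2_eq_square algebra_simps)
  also have "\<dots> = (2 * \<bar>sin (t / 2)\<bar>)\<^sup>2"
    unfolding cos_double_sin by (simp add: power_mult_distrib)
  finally show "(norm (cis t - 1))\<^sup>2 = (2 * \<bar>sin (t / 2)\<bar>)\<^sup>2" .
qed auto

text \<open>Passage from chords to angles: an angle \<open>\<tau>\<close> with
  \<open>|\<tau>| \<le> pi\<close> has chord \<open>2 |sin (\<tau> / 2)| \<ge> |\<tau>| / 2\<close>,
  which is the source of the factor 2.\<close>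

lemma mem_circle_arc:
  assumes w: "w \<in> unit_circle" and \<zeta>: "\<zeta> \<in> unit_circle" and s: "dist w \<zeta> < s"
  shows "w \<in> circle_arc \<zeta> (2 * s)"
proof -
  define \<tau> where "\<tau> = Arg (w / \<zeta>)"
  have nz: "w / \<zeta> \<noteq> 0" using w \<zeta> by auto
  have "cis \<tau> = w / \<zeta>"
    unfolding \<tau>_def cis_Arg[OF nz] using w \<zeta> by (simp add: sgn_eq norm_divide)
  then have wc: "w = \<zeta> * cis \<tau>" using \<zeta> by auto
  have \<tau>: "\<bar>\<tau>\<bar> \<le> pi" using Arg_bounded[of "w / \<zeta>"] by (auto simp: \<tau>_def)
  have "w - \<zeta> = \<zeta> * (cis \<tau> - 1)" by (simp add: wc algebra_simps)
  then have "dist w \<zeta> = norm (cis \<tau> - 1)" using \<zeta> by (simp add: dist_norm norm_mult)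
  moreover have "\<bar>\<tau>\<bar> / 2 / 2 \<le> sin (\<bar>\<tau>\<bar> / 2)" using \<tau> by (intro half_le_sin) auto
  then have "\<bar>\<tau>\<bar> / 2 \<le> norm (cis \<tau> - 1)"
    unfolding norm_cis_minus_1 by (auto simp: abs_if split: if_splits)
  ultimately have "\<bar>\<tau>\<bar> < 2 * s" using s by linarith
  then show ?thesis using wc by (auto simp: circle_arc_def)
qed

lemma dist_cis_le: "dist (cis a) (cis b) \<le> \<bar>a - b\<bar>"
proof -
  have "cis a - cis b = cis b * (cis (a - b) - 1)" by (simp add: algebra_simps cis_mult)
  then have "dist (cis a) (cis b) = norm (cis (a - b) - 1)" by (simp add: dist_norm norm_mult)
  then show ?thesis
    unfolding norm_cis_minus_1 using abs_sin_x_le_abs_x[of "(a - b) / 2"] by simp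
qed

text \<open>The circle is cut into \<open>N\<close> pieces of angular length \<open>s\<close>. If a
  piece contains a point within \<open>s\<close> of some \<open>\<zeta>\<close> in \<open>E\<close>,
  all its points are within \<open>2 * s\<close> of that \<open>\<zeta>\<close>, hence in the arc of
  half-width \<open>4 * s\<close> about it.\<close>

lemma emeasure_neighbourhood_le:
  fixes N :: nat and s :: real
  assumes sets: "sets \<mu> = sets circle_borel" and E: "E \<subseteq> unit_circle" "E \<noteq> {}"
    and s: "s > 0" "2 * pi \<le> N * s"
    and c: "\<And>\<zeta>. \<zeta> \<in> E \<Longrightarrow> emeasure \<mu> (circle_arc \<zeta> (4 * s)) \<le> c"
  shows "emeasure \<mu> {w \<in> unit_circle. infdist w E < s} \<le> of_nat N * c"
proof -
  let ?A = "{w \<in> unit_circle. infdist w E < s}"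
  let ?J = "\<lambda>j::nat. cis ` {real j * s..<(real j + 1) * s}"
  \<comment> \<open>A piece that misses the neighbourhood is assigned an arbitrary point of
    \<open>E\<close>, so that the centres form a total function \<open>Z\<close>.\<close>
  have near: "\<exists>\<zeta>\<in>E. ?A \<inter> ?J j \<subseteq> circle_arc \<zeta> (4 * s)" for j
  proof (cases "?A \<inter> ?J j = {}")
    case False
    then obtain w where "w \<in> ?A" "w \<in> ?J j" by blast
    then obtain \<theta> where \<theta>: "\<theta> \<in> {real j * s..<(real j + 1) * s}" "infdist (cis \<theta>) E < s" by blast
    then obtain \<zeta> where \<zeta>: "\<zeta> \<in> E" "dist (cis \<theta>) \<zeta> < s"
      using E by (auto simp: infdist_notempty cINF_less_iff)
    have "w \<in> circle_arc \<zeta> (4 * s)" if w: "w \<in> ?A \<inter> ?J j" for w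
    proof -
      obtain \<phi> where \<phi>: "\<phi> \<in> {real j * s..<(real j + 1) * s}" "w = cis \<phi>" using w by blast
      have "dist w (cis \<theta>) \<le> \<bar>\<phi> - \<theta>\<bar>" unfolding \<phi> by (rule dist_cis_le)
      also have "\<dots> < s" using \<phi> \<theta> by (auto simp: algebra_simps)
      finally have "dist w \<zeta> < 2 * s" using \<zeta> dist_triangle[of w \<zeta> "cis \<theta>"] by simp
      then show ?thesis using mem_circle_arc[of w \<zeta> "2 * s"] w \<zeta> E by auto
    qed
    then show ?thesis using \<zeta> by blast
  qed (use E in auto)
  then obtain Z where Z: "\<And>j. Z j \<in> E" "\<And>j. ?A \<inter> ?J j \<subseteq> circle_arc (Z j) (4 * s)"
    by metis
  have arcs: "circle_arc (Z j) (4 * s) \<in> sets \<mu>" for j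
    unfolding sets using Z(1) E by (intro sets_circle_arc) blast
  have "?A \<subseteq> (\<Union>j<N. circle_arc (Z j) (4 * s))"
  proof
    fix w assume w: "w \<in> ?A"
    \<comment> \<open>The branch with values in \<open>[0, 2 pi)\<close> makes the index of the
      piece a natural number, and \<open>j * s \<le> \<theta> < 2 * pi \<le> N * s\<close> gives
      \<open>j < N\<close>.\<close>
    define \<theta> where "\<theta> = Arg2pi w"
    have \<theta>: "0 \<le> \<theta>" "\<theta> < 2 * pi" "w = cis \<theta>"
      using w Arg2pi[of w] by (auto simp: \<theta>_def cis_conv_exp is_Arg_def)
    define j where "j = nat \<lfloor>\<theta> / s\<rfloor>"
    have "real j = of_int \<lfloor>\<theta> / s\<rfloor>" using \<theta> s by (simp add: j_def)
    then have j: "real j \<le> \<theta> / s" "\<theta> / s < real j + 1" by linarith+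
    then have j': "j * s \<le> \<theta>" "\<theta> < (j + 1) * s" using s by (auto simp: field_simps)
    then have "j * s < N * s" using \<theta> s by linarith
    then have "j < N" using s by simp
    moreover have "w \<in> ?J j" using j' \<theta>(3) by (intro image_eqI[of _ _ \<theta>]) (simp_all add: add.commute)
    ultimately show "w \<in> (\<Union>j<N. circle_arc (Z j) (4 * s))" using Z(2)[of j] w by blast
  qed
  then have "emeasure \<mu> ?A \<le> emeasure \<mu> (\<Union>j<N. circle_arc (Z j) (4 * s))"
    using arcs by (intro emeasure_mono) auto
  also have "\<dots> \<le> (\<Sum>j<N. emeasure \<mu> (circle_arc (Z j) (4 * s)))"
    using arcs by (intro emeasure_subadditive_finite) auto
  also have "\<dots> \<le> (\<Sum>j<N. c)" using Z by (intro sum_mono c) auto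
  finally show ?thesis by simp
qed

text \<open>For \<open>r \<ge> 1\<close> the summand 1 suffices. For \<open>r < 1\<close> a single
  term does: if \<open>k = n + 1\<close> is the least exponent with
  \<open>(1 / 2)^k \<le> r\<close>, then \<open>r < (1 / 2)^n\<close> and
  \<open>1 / r \<le> 2^(n + 1)\<close>.\<close>

lemma inverse_le_dyadic_sum:
  assumes r: "r > 0"
  shows "ennreal (1 / r) \<le> 1 + (\<Sum>n. ennreal (2 ^ Suc n) * indicator {..<(1 / 2) ^ n} r)"
proof (cases "r < 1")
  case False
  then have "ennreal (1 / r) \<le> 1" by (subst ennreal_le_1) simp
  then show ?thesis by (rule order_trans) simp
next
  case True
  define f where "f = (\<lambda>n. ennreal (2 ^ Suc n) * indicator {..<(1 / 2) ^ n} r)"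
  obtain m where "(1 / 2) ^ m < r" using real_arch_pow_inv[of r "1 / 2"] r by auto
  then have ex: "(1 / 2) ^ m \<le> r" by simp
  define k where "k = (LEAST m. (1 / 2) ^ m \<le> r)"
  have k: "(1 / 2) ^ k \<le> r" unfolding k_def using ex by (rule LeastI)
  then have "k \<noteq> 0" using True by (cases k) auto
  then obtain n where n: "k = Suc n" by (cases k) auto
  have n': "r < (1 / 2) ^ n"
    using not_less_Least[of n "\<lambda>m. (1 / 2) ^ m \<le> r"] n by (simp add: k_def[symmetric])
  have "1 / r \<le> 1 / (1 / 2) ^ k" using k r by (intro divide_left_mono) auto
  then have "1 / r \<le> 2 ^ Suc n" by (simp add: n power_one_over)
  then have "ennreal (1 / r) \<le> f n"
    using n' by (simp add: f_def ennreal_leI del: power_Suc)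
  also have "f n = sum f {n}" by simp
  also have "\<dots> \<le> suminf f" by (intro sum_le_suminf) auto
  also have "\<dots> \<le> 1 + \<dots>" by simp
  finally show ?thesis by (simp only: f_def)
qed

text \<open>Dyadic neighbourhoods of \<open>E\<close> have weighted measures dominated by a
  geometric series. Both conclusions are wanted: since \<open>1 / 0 = 0\<close>, the integral in the
  second does not see mass sitting on \<open>E\<close>.\<close>

lemma neighbourhood_moment:
  assumes sets: "sets \<mu> = sets circle_borel" and fin: "finite_measure \<mu>"
    and E: "E \<subseteq> unit_circle" "E \<noteq> {}" "closed E"
    and \<alpha>: "\<alpha> > 2" and C: "C \<ge> 0"
    and arc: "\<And>\<zeta> t. \<zeta> \<in> E \<Longrightarrow> t > 0 \<Longrightarrow> emeasure \<mu> (circle_arc \<zeta> t) \<le> ennreal (C * t powr \<alpha>)"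
  shows "emeasure \<mu> E = 0" "(\<integral>\<^sup>+ \<xi>. ennreal (1 / infdist \<xi> E) \<partial>\<mu>) < \<infinity>"
proof -
  interpret finite_measure \<mu> by (rule fin)
  have sp: "space \<mu> = unit_circle"
    using sets_eq_imp_space_eq[OF sets] by (simp add: space_restrict_space)
  have bor: "f \<in> borel_measurable \<mu>" if "f \<in> borel_measurable borel" for f :: "complex \<Rightarrow> ennreal"
    using that by (simp add: measurable_cong_sets[OF sets refl] measurable_restrict_space1)
  define A where "A = (\<lambda>n::nat. {w \<in> unit_circle. infdist w E < (1 / 2) ^ n})"
  have As: "A n \<in> sets \<mu>" for n
  proof -
    have "open {w. infdist w E < (1 / 2) ^ n}"
      by (intro open_Collect_less continuous_intros)
    moreover have "A n = unit_circle \<inter> {w. infdist w E < (1 / 2) ^ n}" by (auto simp: A_def)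
    ultimately show ?thesis unfolding sets by (auto simp: sets_restrict_space)
  qed
  have EA: "E \<subseteq> A n" for n using E by (auto simp: A_def)
  \<comment> \<open>With \<open>s = (1 / 2)^n\<close> and \<open>8 * 2^n\<close> pieces, the product
    of the weight \<open>2^(n + 1)\<close>, the number of pieces and the arc bound
    \<open>C * (4 * s) powr \<alpha>\<close> is \<open>K * q^n\<close>. The ratio \<open>q\<close>
    is below 1 exactly when \<open>\<alpha> > 2\<close>.\<close>
  define K where "K = 16 * (C * 4 powr \<alpha>)"
  define q where "q = (2::real) powr (2 - \<alpha>)"
  have K: "K \<ge> 0" and q: "0 \<le> q" "q < 1"
    using C \<alpha> by (auto simp: K_def q_def powr_less_one)
  have bound: "ennreal (2 ^ Suc n) * emeasure \<mu> (A n) \<le> ennreal (K * q ^ n)" for n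
  proof -
    have pw: "((1 / 2) ^ n :: real) powr \<alpha> = 1 / 2 powr (n * \<alpha>)"
      by (simp add: power_one_over powr_divide powr_realpow[symmetric] powr_powr)
    have qn: "q ^ n = 2 ^ n * 2 ^ n / 2 powr (n * \<alpha>)"
    proof -
      have "q ^ n = 2 powr ((2 - \<alpha>) * n)"
        by (simp add: q_def powr_realpow[symmetric] powr_powr)
      also have "(2 - \<alpha>) * n = real n + real n - n * \<alpha>" by (simp add: algebra_simps)
      finally show ?thesis by (simp only: powr_diff powr_add) (simp add: powr_realpow)
    qed
    have "2 * pi \<le> 8" using pi_less_4 by simp
    then have "emeasure \<mu> (A n) \<le> of_nat (8 * 2 ^ n) * ennreal (C * (4 * (1 / 2) ^ n) powr \<alpha>)"
      unfolding A_def
      by (intro emeasure_neighbourhood_le sets E arc) (auto simp: power_one_over)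
    also have "\<dots> = ennreal (8 * 2 ^ n * (C * (4 * (1 / 2) ^ n) powr \<alpha>))"
      using C by (subst ennreal_of_nat_eq_real_of_nat) (simp flip: ennreal_mult)
    finally have "ennreal (2 ^ Suc n) * emeasure \<mu> (A n)
        \<le> ennreal (2 ^ Suc n) * ennreal (8 * 2 ^ n * (C * (4 * (1 / 2) ^ n) powr \<alpha>))"
      by (rule mult_left_mono) simp
    also have "\<dots> = ennreal (2 ^ Suc n * (8 * 2 ^ n * (C * (4 * (1 / 2) ^ n) powr \<alpha>)))"
      using C by (intro ennreal_mult[symmetric]) auto
    also have "2 ^ Suc n * (8 * 2 ^ n * (C * (4 * (1 / 2) ^ n) powr \<alpha>)) = K * q ^ n"
      unfolding powr_mult pw qn K_def by simp
    finally show ?thesis .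
  qed
  \<comment> \<open>The weights are at least 1, so the weighted bound also controls
    \<open>emeasure \<mu> E\<close> for every n.\<close>
  have "(\<lambda>n. ennreal (K * q ^ n)) \<longlonglongrightarrow> ennreal (K * 0)"
    using q by (intro tendsto_ennrealI tendsto_mult tendsto_const LIMSEQ_power_zero) auto
  moreover have "emeasure \<mu> E \<le> ennreal (K * q ^ n)" for n
  proof -
    have "emeasure \<mu> E \<le> 1 * emeasure \<mu> (A n)" using EA As by (simp add: emeasure_mono)
    also have "\<dots> \<le> ennreal (2 ^ Suc n) * emeasure \<mu> (A n)"
      by (intro mult_right_mono) (auto intro: one_le_power simp del: power_Suc)
    finally show ?thesis using bound[of n] by simp
  qed
  ultimately show "emeasure \<mu> E = 0"
    using LIMSEQ_le_const[of "\<lambda>n. ennreal (K * q ^ n)" "ennreal (K * 0)" "emeasure \<mu> E"] by auto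
  then have "AE \<xi> in \<mu>. \<xi> \<notin> E"
    using E sets by (intro AE_not_in) (auto simp: null_sets_def sets_restrict_space_iff)
  then have "AE \<xi> in \<mu>. ennreal (1 / infdist \<xi> E)
      \<le> 1 + (\<Sum>n. ennreal (2 ^ Suc n) * indicator (A n) \<xi>)"
    using AE_space
  proof eventually_elim
    case (elim \<xi>)
    then have "infdist \<xi> E > 0" using E by (intro infdist_pos_not_in_closed) auto
    then have "ennreal (1 / infdist \<xi> E)
        \<le> 1 + (\<Sum>n. ennreal (2 ^ Suc n) * indicator {..<(1 / 2) ^ n} (infdist \<xi> E))"
      by (rule inverse_le_dyadic_sum)
    also have "(\<lambda>n. indicator {..<(1 / 2) ^ n} (infdist \<xi> E)) = (\<lambda>n. indicator (A n) \<xi> :: ennreal)"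
      using elim by (auto simp: A_def sp fun_eq_iff split: split_indicator)
    finally show ?case .
  qed
  then have "(\<integral>\<^sup>+ \<xi>. ennreal (1 / infdist \<xi> E) \<partial>\<mu>)
      \<le> (\<integral>\<^sup>+ \<xi>. 1 + (\<Sum>n. ennreal (2 ^ Suc n) * indicator (A n) \<xi>) \<partial>\<mu>)"
    by (rule nn_integral_mono_AE)
  also have "\<dots> = emeasure \<mu> (space \<mu>) + (\<Sum>n. ennreal (2 ^ Suc n) * emeasure \<mu> (A n))"
    using As by (subst nn_integral_add) (simp_all add: nn_integral_suminf nn_integral_cmult_indicator del: power_Suc)
  also have "\<dots> \<le> emeasure \<mu> (space \<mu>) + (\<Sum>n. ennreal (K * q ^ n))"
    by (intro add_left_mono suminf_le bound summableI)
  also have "\<dots> = emeasure \<mu> (space \<mu>) + ennreal (\<Sum>n. K * q ^ n)"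
    using K q by (subst suminf_ennreal2) (auto intro!: summable_mult summable_geometric)
  also have "\<dots> < \<infinity>" by (simp add: emeasure_eq_measure)
  finally show "(\<integral>\<^sup>+ \<xi>. ennreal (1 / infdist \<xi> E) \<partial>\<mu>) < \<infinity>" .
qed

text \<open>The asymptotic bound holds only for \<open>t < t0\<close>. For larger \<open>t\<close>
  the total mass \<open>M\<close> is at most
  \<open>(M / t0 powr \<alpha>) * t powr \<alpha>\<close>, so adding this constant gives a bound for
  all \<open>t > 0\<close>, as the covering at every dyadic scale requires.\<close>

lemma arc_modulus_bigo_bound:
  assumes fin: "finite_measure \<mu>" and O: "arc_modulus \<mu> E \<in> O[at_right 0](\<lambda>t. t powr \<alpha>)" and \<alpha>: "\<alpha> \<ge> 0"
  obtains C where "C \<ge> 0"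
    "\<And>\<zeta> t. \<zeta> \<in> E \<Longrightarrow> t > 0 \<Longrightarrow> emeasure \<mu> (circle_arc \<zeta> t) \<le> ennreal (C * t powr \<alpha>)"
proof -
  interpret finite_measure \<mu> by (rule fin)
  \<comment> \<open>Finiteness of \<open>\<mu>\<close> matters here: \<open>enn2real\<close> would
    send an infinite supremum to 0.\<close>
  have le: "emeasure \<mu> (circle_arc \<zeta> t) \<le> ennreal (arc_modulus \<mu> E t)" if "\<zeta> \<in> E" for \<zeta> t
  proof -
    have "(SUP \<zeta>\<in>E. emeasure \<mu> (circle_arc \<zeta> t)) \<le> emeasure \<mu> (space \<mu>)"
      by (intro SUP_least emeasure_space)
    also have "\<dots> < top" using emeasure_finite[of "space \<mu>"] less_top by blast
    finally have "ennreal (arc_modulus \<mu> E t) = (SUP \<zeta>\<in>E. emeasure \<mu> (circle_arc \<zeta> t))"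
      unfolding arc_modulus_def by (rule ennreal_enn2real)
    then show ?thesis using that by (auto intro: SUP_upper)
  qed
  obtain c where c: "c > 0" "\<forall>\<^sub>F t in at_right 0. norm (arc_modulus \<mu> E t) \<le> c * norm (t powr \<alpha>)"
    using O by (elim landau_o.bigE)
  then obtain t0 where t0: "t0 > 0" "\<And>t. 0 < t \<Longrightarrow> t < t0 \<Longrightarrow> norm (arc_modulus \<mu> E t) \<le> c * norm (t powr \<alpha>)"
    unfolding eventually_at_right_field by blast
  define M where "M = measure \<mu> (space \<mu>)"
  have M: "M \<ge> 0" "emeasure \<mu> (space \<mu>) = ennreal M" by (auto simp: M_def emeasure_eq_measure)
  show thesis
  proof
    show "c + M / t0 powr \<alpha> \<ge> 0" using c M by simp
    fix \<zeta> t assume \<zeta>: "\<zeta> \<in> E" and t: "(t::real) > 0"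
    show "emeasure \<mu> (circle_arc \<zeta> t) \<le> ennreal ((c + M / t0 powr \<alpha>) * t powr \<alpha>)"
    proof (cases "t < t0")
      case True
      then have "arc_modulus \<mu> E t \<le> c * t powr \<alpha>" using t0(2)[OF t True] by simp
      also have "\<dots> \<le> (c + M / t0 powr \<alpha>) * t powr \<alpha>"
        using M by (intro mult_right_mono) auto
      finally show ?thesis using le[OF \<zeta>, of t] by (meson ennreal_leI order_trans)
    next
      case False
      have "emeasure \<mu> (circle_arc \<zeta> t) \<le> ennreal M" unfolding M(2)[symmetric] by (rule emeasure_space)
      also have "M = (M / t0 powr \<alpha>) * t0 powr \<alpha>" using t0 by simp
      also have "ennreal \<dots> \<le> ennreal ((c + M / t0 powr \<alpha>) * t powr \<alpha>)"
        using False t0 c M \<alpha> by (intro ennreal_leI mult_mono powr_mono2) auto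
      finally show ?thesis .
    qed
  qed
qed

section \<open>Vanishing energy of the test functions, and the capacity\<close>

text \<open>Dominated convergence is nested: at fixed \<open>\<xi>\<close> off \<open>E\<close> the
  kernel with shifted pole dominates in \<open>w\<close> and gives
  \<open>D n \<xi> \<longlonglongrightarrow> 0\<close>; its integral bound then dominates in
  \<open>\<xi>\<close>.\<close>

lemma dirichlet_norm_sq_bump_tendsto_0:
  assumes sets: "sets \<mu> = sets circle_borel" and fin: "finite_measure \<mu>"
    and E: "E \<subseteq> unit_circle" "E \<noteq> {}" "closed E" "E \<in> null_sets circle_measure"
    and \<mu>E: "emeasure \<mu> E = 0"
    and moment: "(\<integral>\<^sup>+ \<xi>. ennreal (1 / infdist \<xi> E) \<partial>\<mu>) < \<infinity>"
  shows "(\<lambda>n. dirichlet_norm_sq \<mu> (\<lambda>w. of_real (bump E (real n) w))) \<longlonglongrightarrow> 0"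
proof -
  interpret C: prob_space circle_measure by (rule prob_space_circle_measure)
  have sp: "space \<mu> = unit_circle"
    using sets_eq_imp_space_eq[OF sets] by (simp add: space_restrict_space)
  define u where "u = (\<lambda>n w. complex_of_real (bump E (real n) w))"
  have pos: "infdist \<xi> E > 0" if "\<xi> \<notin> E" for \<xi>
    using that E by (intro infdist_pos_not_in_closed) auto
  have ev0: "\<forall>\<^sub>F n in sequentially. u n \<xi> = 0" if "\<xi> \<notin> E" for \<xi>
  proof -
    obtain N :: nat where N: "2 / infdist \<xi> E < N" using reals_Archimedean2 by blast
    have "u n \<xi> = 0" if "n \<ge> N" for n
    proof -
      have "2 < N * infdist \<xi> E" using N pos[OF \<open>\<xi> \<notin> E\<close>] by (simp add: field_simps)
      also have "\<dots> \<le> n * infdist \<xi> E" using that by (intro mult_right_mono infdist_nonneg) auto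
      finally show ?thesis by (simp add: u_def bump_eq_0)
    qed
    then show ?thesis by (auto simp: eventually_sequentially)
  qed
  have lip: "(real n)-lipschitz_on unit_circle (u n)" for n
    by (intro lipschitz_onI) (auto simp: u_def dist_norm bump_diff_le[unfolded dist_norm] simp flip: of_real_diff)
  have um: "u n \<in> borel_measurable borel" for n
    unfolding u_def bump_def by (intro borel_measurable_continuous_onI continuous_intros)
  have nu: "norm (u n w) \<le> 1" for n w using bump_bounds[of E n w] by (simp add: u_def)
  have nE: "AE w in circle_measure. w \<notin> E" using E by (intro AE_not_in)
  have borC: "f \<in> borel_measurable circle_measure" if "f \<in> borel_measurable borel" for f :: "complex \<Rightarrow> ennreal"
    using that by (simp add: measurable_cong_sets[OF sets_circle_measure refl] measurable_restrict_space1)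
  have bor\<mu>: "f \<in> borel_measurable \<mu>" if "f \<in> borel_measurable borel" for f :: "complex \<Rightarrow> ennreal"
    using that by (simp add: measurable_cong_sets[OF sets refl] measurable_restrict_space1)
  note [measurable] = um
  have "(\<lambda>n. \<integral>\<^sup>+ w. ennreal ((norm (u n w))\<^sup>2) \<partial>circle_measure) \<longlonglongrightarrow> (\<integral>\<^sup>+ w. 0 \<partial>circle_measure)"
  proof (rule nn_integral_dominated_convergence[where w = "\<lambda>_. 1"])
    show "AE w in circle_measure. ennreal ((norm (u n w))\<^sup>2) \<le> 1" for n
      using nu by (auto intro!: AE_I2 power_le_one)
    show "AE w in circle_measure. (\<lambda>n. ennreal ((norm (u n w))\<^sup>2)) \<longlonglongrightarrow> 0"
      using nE
    proof eventually_elim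
      case (elim w)
      from ev0[OF this] show ?case
        by (intro tendsto_eventually) (auto elim!: eventually_mono)
    qed
    show "(\<lambda>w. ennreal ((norm (u n w))\<^sup>2)) \<in> borel_measurable circle_measure" for n
      by (intro borC) measurable
  qed (auto simp: C.emeasure_space_1[simplified])
  then have 1: "(\<lambda>n. \<integral>\<^sup>+ w. ennreal ((norm (u n w))\<^sup>2) \<partial>circle_measure) \<longlonglongrightarrow> 0" by simp
  \<comment> \<open>An explicit integral that agrees with \<open>local_dirichlet (u n)\<close> on
    the circle; its measurability in \<open>\<xi>\<close> follows from joint measurability of the
    integrand.\<close>
  define D where "D = (\<lambda>n \<xi>. \<integral>\<^sup>+ w. ennreal ((norm (u n w - u n \<xi>))\<^sup>2 / (norm (w - \<xi>))\<^sup>2) \<partial>circle_measure)"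
  have Dloc: "local_dirichlet (u n) \<xi> = D n \<xi>" if "\<xi> \<in> unit_circle" for n \<xi>
    unfolding D_def using lip that by (rule local_dirichlet_lipschitz)
  have quot_le: "ennreal ((norm (u n w - u n \<xi>))\<^sup>2 / (norm (w - \<xi>))\<^sup>2)
      \<le> ennreal (4 / (norm (w - of_real (1 - infdist \<xi> E / 4) * \<xi>))\<^sup>2)"
    and k: "0 < infdist \<xi> E / 4" "infdist \<xi> E / 4 \<le> 1"
    if "\<xi> \<in> unit_circle" "\<xi> \<notin> E" "w \<in> unit_circle" for n \<xi> w
  proof -
    define k where "k = infdist \<xi> E / 4"
    \<comment> \<open>Points of the circle are at most 2 apart, so \<open>k \<le> 1 / 2\<close> and
      the shifted pole stays on the radius to \<open>\<xi>\<close>.\<close>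
    obtain e where e: "e \<in> E" using E by blast
    have "infdist \<xi> E \<le> dist \<xi> e" using e by (rule infdist_le)
    also have "\<dots> \<le> norm \<xi> + norm e" by (simp add: dist_norm norm_triangle_ineq4)
    also have "\<dots> = 2" using that e E by auto
    finally have k: "0 < k" "k \<le> 1" using pos[OF that(2)] by (auto simp: k_def)
    then show "0 < infdist \<xi> E / 4" "infdist \<xi> E / 4 \<le> 1" by (auto simp: k_def)
    have n: "norm (of_real (1 - k) * \<xi>) = 1 - k"
      using that k unfolding norm_mult norm_of_real by simp
    have d: "norm (u n w - u n \<xi>) = \<bar>bump E n w - bump E n \<xi>\<bar>"
      by (simp add: u_def flip: of_real_diff)
    have "w - of_real (1 - k) * \<xi> = (w - \<xi>) + of_real k * \<xi>" by (simp add: algebra_simps)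
    then have "norm (w - of_real (1 - k) * \<xi>) \<le> norm (w - \<xi>) + norm (of_real k * \<xi>)"
      by (metis norm_triangle_ineq)
    also have "norm (of_real k * \<xi>) = k" using that k by (simp add: norm_mult)
    finally have p: "norm (w - of_real (1 - k) * \<xi>) \<le> norm (w - \<xi>) + k" .
    have "norm (w - of_real (1 - k) * \<xi>) > 0"
      using that k n by (intro norm_diff_on_circle_pos) auto
    moreover have "norm (u n w - u n \<xi>) \<le> 1"
      unfolding d using bump_bounds[of E n w] bump_bounds[of E n \<xi>] by linarith
    moreover have "norm (u n w - u n \<xi>) \<le> norm (w - \<xi>) / k"
      unfolding d k_def using bump_diff_le_infdist[OF _ pos[OF that(2)], of n w] by (simp add: dist_norm)
    ultimately show "ennreal ((norm (u n w - u n \<xi>))\<^sup>2 / (norm (w - \<xi>))\<^sup>2)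
      \<le> ennreal (4 / (norm (w - of_real (1 - infdist \<xi> E / 4) * \<xi>))\<^sup>2)"
      unfolding k_def[symmetric] using k p
      by (intro ennreal_leI difference_quotient_le[where k = k]) auto
  qed
  have "(\<lambda>n. \<integral>\<^sup>+ \<xi>. D n \<xi> \<partial>\<mu>) \<longlonglongrightarrow> (\<integral>\<^sup>+ \<xi>. 0 \<partial>\<mu>)"
  proof (rule nn_integral_dominated_convergence[where w = "\<lambda>\<xi>. 16 * ennreal (1 / infdist \<xi> E)"])
    have nE\<mu>: "AE \<xi> in \<mu>. \<xi> \<notin> E"
      using E sets \<mu>E by (intro AE_not_in) (auto simp: null_sets_def sets_restrict_space_iff)
    show "AE \<xi> in \<mu>. D n \<xi> \<le> 16 * ennreal (1 / infdist \<xi> E)" for n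
      using nE\<mu> AE_space
    proof eventually_elim
      case (elim \<xi>)
      then have \<xi>: "\<xi> \<in> unit_circle" "\<xi> \<notin> E" by (auto simp: sp)
      have "D n \<xi> \<le> (\<integral>\<^sup>+ w. ennreal (4 / (norm (w - of_real (1 - infdist \<xi> E / 4) * \<xi>))\<^sup>2) \<partial>circle_measure)"
        unfolding D_def using quot_le[OF \<xi>] by (intro nn_integral_mono) simp
      also have "\<dots> \<le> ennreal (4 / (infdist \<xi> E / 4))"
        using \<xi> k[OF \<xi> \<xi>(1)] by (intro nn_integral_shifted_inverse_square_le) auto
      also have "\<dots> = ennreal (16 * (1 / infdist \<xi> E))" by simp
      also have "\<dots> = 16 * ennreal (1 / infdist \<xi> E)"
        by (subst ennreal_mult') auto
      finally show ?case .
    qed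
    show "AE \<xi> in \<mu>. (\<lambda>n. D n \<xi>) \<longlonglongrightarrow> 0"
      using nE\<mu> AE_space
    proof eventually_elim
      case (elim \<xi>)
      then have \<xi>: "\<xi> \<in> unit_circle" "\<xi> \<notin> E" by (auto simp: sp)
      have "(\<lambda>n. D n \<xi>) \<longlonglongrightarrow> (\<integral>\<^sup>+ w. 0 \<partial>circle_measure)"
        unfolding D_def
      proof (rule nn_integral_dominated_convergence[where
            w = "\<lambda>w. ennreal (4 / (norm (w - of_real (1 - infdist \<xi> E / 4) * \<xi>))\<^sup>2)"])
        show "AE w in circle_measure. ennreal ((norm (u n w - u n \<xi>))\<^sup>2 / (norm (w - \<xi>))\<^sup>2)
            \<le> ennreal (4 / (norm (w - of_real (1 - infdist \<xi> E / 4) * \<xi>))\<^sup>2)" for n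
          using quot_le[OF \<xi>] by (intro AE_I2) simp
        have "(\<integral>\<^sup>+ w. ennreal (4 / (norm (w - of_real (1 - infdist \<xi> E / 4) * \<xi>))\<^sup>2) \<partial>circle_measure)
            \<le> ennreal (4 / (infdist \<xi> E / 4))"
          using \<xi> k[OF \<xi> \<xi>(1)] by (intro nn_integral_shifted_inverse_square_le) auto
        also have "\<dots> < \<infinity>" by simp
        finally show "(\<integral>\<^sup>+ w. ennreal (4 / (norm (w - of_real (1 - infdist \<xi> E / 4) * \<xi>))\<^sup>2) \<partial>circle_measure) < \<infinity>" .
        show "AE w in circle_measure. (\<lambda>n. ennreal ((norm (u n w - u n \<xi>))\<^sup>2 / (norm (w - \<xi>))\<^sup>2)) \<longlonglongrightarrow> 0"
          using nE
        proof eventually_elim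
          case (elim w)
          from ev0[OF this] ev0[OF \<xi>(2)]
          have "\<forall>\<^sub>F n in sequentially. u n w - u n \<xi> = 0"
            by eventually_elim simp
          then show ?case
            by (intro tendsto_eventually) (auto elim!: eventually_mono)
        qed
        show "(\<lambda>w. ennreal ((norm (u n w - u n \<xi>))\<^sup>2 / (norm (w - \<xi>))\<^sup>2)) \<in> borel_measurable circle_measure" for n
          by (intro borC) measurable
        show "(\<lambda>w. ennreal (4 / (norm (w - of_real (1 - infdist \<xi> E / 4) * \<xi>))\<^sup>2)) \<in> borel_measurable circle_measure"
          by (intro borC) measurable
      qed simp
      then show ?case by simp
    qed
    show "D n \<in> borel_measurable \<mu>" for n
    proof -
      have "(\<lambda>(\<xi>, w). ennreal ((norm (u n w - u n \<xi>))\<^sup>2 / (norm (w - \<xi>))\<^sup>2)) \<in> borel_measurable (borel \<Otimes>\<^sub>M borel)"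
        by measurable
      moreover have "(\<lambda>x. x) \<in> measurable (borel \<Otimes>\<^sub>M circle_measure) (borel \<Otimes>\<^sub>M borel)"
        unfolding measurable_pair_iff
        by (auto simp: o_def intro!: measurable_compose[OF measurable_snd] measurable_restrict_space1
            simp: measurable_cong_sets[OF sets_circle_measure refl])
      ultimately have "(\<lambda>(\<xi>, w). ennreal ((norm (u n w - u n \<xi>))\<^sup>2 / (norm (w - \<xi>))\<^sup>2))
          \<in> borel_measurable (borel \<Otimes>\<^sub>M circle_measure)"
        using measurable_compose by blast
      then have "D n \<in> borel_measurable borel"
        unfolding D_def by (intro C.borel_measurable_nn_integral)
      then show ?thesis by (rule bor\<mu>)
    qed
    have im: "(\<lambda>\<xi>. ennreal (1 / infdist \<xi> E)) \<in> borel_measurable \<mu>"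
    proof (rule bor\<mu>)
      have [measurable]: "(\<lambda>\<xi>. infdist \<xi> E) \<in> borel_measurable borel"
        by (intro borel_measurable_continuous_onI continuous_intros)
      show "(\<lambda>\<xi>. ennreal (1 / infdist \<xi> E)) \<in> borel_measurable borel" by measurable
    qed
    then show "(\<lambda>\<xi>. 16 * ennreal (1 / infdist \<xi> E)) \<in> borel_measurable \<mu>" by measurable
    show "(\<integral>\<^sup>+ \<xi>. 16 * ennreal (1 / infdist \<xi> E) \<partial>\<mu>) < \<infinity>"
      using moment by (subst nn_integral_cmult[OF im]) (simp add: ennreal_mult_less_top)
  qed simp
  then have "(\<lambda>n. \<integral>\<^sup>+ \<xi>. D n \<xi> \<partial>\<mu>) \<longlonglongrightarrow> 0" by simp
  moreover have "(\<integral>\<^sup>+ \<xi>. D n \<xi> \<partial>\<mu>) = dirichlet_integral \<mu> (u n)" for n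
    unfolding dirichlet_integral_def using Dloc by (intro nn_integral_cong) (simp add: sp)
  ultimately have "(\<lambda>n. dirichlet_integral \<mu> (u n)) \<longlonglongrightarrow> 0" by simp
  then have "(\<lambda>n. dirichlet_norm_sq \<mu> (u n)) \<longlonglongrightarrow> 0 + 0"
    unfolding dirichlet_norm_sq_def by (intro tendsto_add 1)
  then show ?thesis by (simp add: u_def)
qed

lemma capacity_le_dirichlet_norm_sq:
  assumes u: "u \<in> borel_measurable circle_measure" "dirichlet_norm_sq \<mu> u < \<infinity>"
    and r: "\<And>w. u w \<in> \<real>" "\<And>w. 0 \<le> Re (u w)"
    and U: "openin (top_of_set unit_circle) U" "F \<subseteq> U" "\<And>w. w \<in> U \<Longrightarrow> 1 \<le> Re (u w)"
  shows "capacity \<mu> F \<le> dirichlet_norm_sq \<mu> u"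
proof -
  have "(\<integral>\<^sup>+ w. ennreal ((norm (u w))\<^sup>2) \<partial>circle_measure) \<le> dirichlet_norm_sq \<mu> u"
    by (simp add: dirichlet_norm_sq_def)
  then have "u \<in> harmonic_dirichlet_space \<mu>"
    using u by (simp add: harmonic_dirichlet_space_def L2_circle_def)
  then have "open_capacity \<mu> U \<le> dirichlet_norm_sq \<mu> u"
    unfolding open_capacity_def using r U by (intro Inf_lower) auto
  moreover have "capacity \<mu> F \<le> open_capacity \<mu> U"
    unfolding capacity_def using U by (intro Inf_lower) auto
  ultimately show ?thesis by simp
qed

theorem mainTheorem6:
  fixes \<mu> :: "complex measure" and E :: "complex set" and \<alpha> :: real
  assumes "finite_measure \<mu>" and "sets \<mu> = sets circle_borel"
    and "closed E" and "E \<subseteq> unit_circle" and "E \<in> null_sets circle_measure"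
    and "\<alpha> > 2"
    and "arc_modulus \<mu> E \<in> O[at_right 0](\<lambda>t. t powr \<alpha>)"
  shows "capacity \<mu> E = 0"
proof (cases "E = {}")
  \<comment> \<open>The distance to the empty set is 0 by convention, so every \<open>bump\<close>
    would be constantly 1; the zero function with \<open>U = {}\<close> is the competitor
    instead.\<close>
  case True
  have sp: "space \<mu> = unit_circle"
    using sets_eq_imp_space_eq[OF assms(2)] by (simp add: space_restrict_space)
  have "0-lipschitz_on unit_circle (\<lambda>_. 0 :: complex)" by (intro lipschitz_onI) auto
  then have "dirichlet_integral \<mu> (\<lambda>_. 0) = (\<integral>\<^sup>+ \<xi>. 0 \<partial>\<mu>)"
    unfolding dirichlet_integral_def
    by (intro nn_integral_cong) (simp add: sp local_dirichlet_lipschitz)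
  then have 0: "dirichlet_norm_sq \<mu> (\<lambda>_. 0) = 0" by (simp add: dirichlet_norm_sq_def)
  have "capacity \<mu> E \<le> dirichlet_norm_sq \<mu> (\<lambda>_. 0)"
    using True by (intro capacity_le_dirichlet_norm_sq[where U = "{}"]) (auto simp: 0)
  then show ?thesis by (simp add: 0)
next
  case False
  have "\<alpha> \<ge> 0" using assms(6) by simp
  with assms obtain C where C: "C \<ge> 0"
    "\<And>\<zeta> t. \<zeta> \<in> E \<Longrightarrow> t > 0 \<Longrightarrow> emeasure \<mu> (circle_arc \<zeta> t) \<le> ennreal (C * t powr \<alpha>)"
    using arc_modulus_bigo_bound[of \<mu> E \<alpha>] by blast
  note moment = neighbourhood_moment[OF assms(2,1,4) False assms(3,6) C]
  let ?u = "\<lambda>n w. complex_of_real (bump E (real n) w)"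
  have lim: "(\<lambda>n. dirichlet_norm_sq \<mu> (?u n)) \<longlonglongrightarrow> 0"
    by (rule dirichlet_norm_sq_bump_tendsto_0[OF assms(2,1,4) False assms(3,5) moment])
  \<comment> \<open>Only finiteness is wanted from this bound: it places the test functions in
    \<open>harmonic_dirichlet_space \<mu>\<close>.\<close>
  then have "\<forall>\<^sub>F n in sequentially. dirichlet_norm_sq \<mu> (?u n) < 1"
    by (rule order_tendstoD) simp
  moreover have "\<forall>\<^sub>F n in sequentially. n > 0" by (rule eventually_gt_at_top)
  ultimately have "\<forall>\<^sub>F n in sequentially. capacity \<mu> E \<le> dirichlet_norm_sq \<mu> (?u n)"
  proof eventually_elim
    case (elim n)
    show ?case
    proof (rule capacity_le_dirichlet_norm_sq[where U = "unit_circle \<inter> {w. n * infdist w E < 1}"])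
      show "?u n \<in> borel_measurable circle_measure"
        unfolding bump_def by (intro borel_measurable_circle_measure_continuous continuous_intros)
      show "dirichlet_norm_sq \<mu> (?u n) < \<infinity>"
        using elim(1) by (rule less_trans) simp
      have "open {w. n * infdist w E < 1}"
        by (intro open_Collect_less continuous_intros)
      then show "openin (top_of_set unit_circle) (unit_circle \<inter> {w. n * infdist w E < 1})"
        by (auto simp: openin_open)
      show "E \<subseteq> unit_circle \<inter> {w. n * infdist w E < 1}" using assms(4) by auto
      show "1 \<le> Re (?u n w)" if "w \<in> unit_circle \<inter> {w. n * infdist w E < 1}" for w
        using that by (simp add: bump_eq_1)
    qed (auto simp: bump_bounds)
  qed
  with lim have "capacity \<mu> E \<le> 0"
    by (intro tendsto_lowerbound[OF lim]) auto
  then show ?thesis by simp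
qed

end
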